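(* Let $\mathcal G=(\mathcal V,\mathcal E,\omega)$ be a connected weighted hypergraph, let $\mathbf G$, $\mathbf A_\theta$, $\phi$, $\mathcal S_\phi$, $\mathbf Q_\phi$, $R_\theta$, $\tau_\eta$, $\mathcal R_\eta$ be as defined in the context, and let $\{\mathbf S_R(t)\}_{t\ge0}$ be the global continuous semiflow on $\mathcal X=\mathbb R^{n\times d}$ generated by the HNRD equation $$\frac{d\mathbf X(t)}{dt}=-\mathbf G^\top\mathbf A_\theta(\mathbf X(t))\,\mathbf G\,\mathbf X(t)+\mathcal R_\eta(\mathbf X(t)),\qquad \mathbf X(0)=\mathbf X_0 .$$ Let $\mathbf L_H\in\mathbb R^{n\times n}$ be a symmetric positive semidefinite matrix with $\mathbf L_H\phi=0$ and $\ker(\mathbf L_H)=\operatorname{span}\{\phi\}$, and let $\mathcal E_\phi(\mathbf X):=\frac12\langle\mathbf Q_\phi\mathbf X,\mathbf L_H\mathbf Q_\phi\mathbf X\rangle_F$. Assume that $\mathbf Q_\phi\mathbf X_0\ne0$. Then $$\frac{\lambda_{H,\max}}{2}\tau_\eta\ \ge\ \limsup_{t\to\infty}\mathcal E_\phi(\mathbf S_R(t)\mathbf X_0)\ \ge\ \liminf_{t\to\infty}\mathcal E_\phi(\mathbf S_R(t)\mathbf X_0)\ \ge\ \frac{\lambda_{H,2}}{2}\tau_\eta,$$ where $$\lambda_{H,2}:=\min_{\mathbf Z\in\mathcal S_\phi^\perp,\ \|\mathbf Z\|_F=1}\langle\mathbf Z,\mathbf L_H\mathbf Z\rangle_F>0,\qquad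 \lambda_{H,\max}:=\max_{\mathbf Z\in\mathcal S_\phi^\perp,\ \|\mathbf Z\|_F=1}\langle\mathbf Z,\mathbf L_H\mathbf Z\rangle_F .$$
   Context: Hypergraph. $\mathcal V$ is a finite set of $n\ge 2$ nodes, $\mathcal E$ a finite set of hyperedges, each $e\in\mathcal E$ being a subset of $\mathcal V$ with $|e|\ge 2$, and $\omega_e>0$ is the weight of $e$. The degree of $v$ is $d_v=\#\{e\in\mathcal E: v\in e\}$ (unweighted). The hypergraph is connected if any two nodes can be joined by a finite sequence of nodes in which consecutive nodes lie in a common hyperedge; then $d_v\ge 1$ for all $v$. The incidence set is $\mathcal I=\{(e,v): e\in\mathcal E, v\in e\}$ and $N=|\mathcal I|$. Phase space. $\mathcal X=\mathbb R^{n\times d}$ with Frobenius inner product $\langle\cdot,\cdot\rangle_F$ and norm $\|\cdot\|_F$; row $\mathbf X_v$ of $\mathbf X$ is the representation of node $v$. Gradient matrix. $\mathbf G\in\mathbb R^{N\times n}$ is $\mathbf G=\mathbf\Omega_{\mathcal I}^{1/2}\mathbf P$, where $\mathbf\Omega_{\mathcal I}=\operatorname{diag}(\omega_e)_{(e,v)\in\mathcal I}$ and $(\mathbf P\mathbf f)(e,v)=\frac{\mathbf f(v)}{\sqrt{d_v}}-\frac1{|e|}\sum_{u\in e}\frac{\mathbf f(u)}{\sqrt{d_u}}$; it acts on $\mathbf X\in\mathcal X$ columnwise. Modulation. Fix parameters $\theta$ and $0<\varepsilon<1$. For $\mathbf X\in\mathcal X$ let $\mathbf X_e=\operatorname{Agg}(\{\mathbf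 X_u:u\in e\})\in\mathbb R^d$, with $\operatorname{Agg}$ a permutation-invariant, locally Lipschitz aggregator (such as mean or max pooling), and $r^\theta_{(e,v)}=\sigma(\operatorname{MLP}_\theta(\mathbf X_v\,\|\,\mathbf X_e))\in\mathbb R$, where $\|$ is concatenation, $\sigma$ is LeakyReLU and $\operatorname{MLP}_\theta:\mathbb R^{2d}\to\mathbb R$ is a (locally Lipschitz) multilayer perceptron. Set $$a_\theta(\mathbf X_v,\mathbf X_e)=(1-\varepsilon)\frac{\exp(r^\theta_{(e,v)})}{\sum_{e'\ni v}\exp(r^\theta_{(e',v)})}+\frac{\varepsilon}{d_v},\qquad \mathbf A_\theta(\mathbf X)=\operatorname{diag}(a_\theta(\mathbf X_v,\mathbf X_e))_{(e,v)\in\mathcal I}\in\mathbb R^{N\times N}.$$ Null mode. $\mathbf D_v=\operatorname{diag}(d_v)_{v\in\mathcal V}$, $\phi=\mathbf D_v^{1/2}\mathbf 1\in\mathbb R^n$, $\mathcal S_\phi=\{\phi c: c\in\mathbb R^{1\times d}\}\subset\mathcal X$; $\mathcal S_\phi^\perp$ is its orthogonal complement in $\mathcal X$, $\mathbf\Pi_\phi$ the orthogonal projector onto $\mathcal S_\phi$, and $\mathbf Q_\phi=\mathbf I-\mathbf\Pi_\phi$. Reaction term. With $\mathbf Z=\mathbf Q_\phi\mathbf X$, $$R_\theta(\mathbf X)=\frac{\langle\mathbf G\mathbf Z,\mathbf A_\theta(\mathbf X)\mathbf G\mathbf Z\rangle_F}{\|\mathbf Z\|_F^2}\ \text{ if }\mathbf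 Z\ne0,\qquad R_\theta(\mathbf X)=0\ \text{ if }\mathbf Z=0,$$ $$\mathcal R_\eta(\mathbf X)=\bigl[R_\theta(\mathbf X)+\tanh(\tau_\eta-\|\mathbf Q_\phi\mathbf X\|_F^2)\bigr]\mathbf Q_\phi\mathbf X,\qquad \tau_\eta=\operatorname{softplus}(\eta)=\log(1+e^\eta)>0,\ \eta\in\mathbb R\text{ fixed}.$$ Semiflow. For every $\mathbf X_0\in\mathcal X$ the HNRD equation has a unique global $C^1$ solution $\mathbf X(t;\mathbf X_0)$ on $[0,\infty)$, and $\mathbf S_R(t)\mathbf X_0:=\mathbf X(t;\mathbf X_0)$. *)

theory Defs
  imports "HOL-Analysis.Analysis"
begin

text \<open>
  The node set is a finite type \<open>'v\<close>, and the phase space of \<open>n \<times> d\<close> real matrices is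
  \<open>real^'d^'v\<close> with \<open>n = CARD('v)\<close> and \<open>d = CARD('d)\<close>.  The inner product and the norm
  of this type are the Frobenius ones, and \<open>X $ v\<close> is the row of \<open>X\<close> at \<open>v\<close>.
\<close>

definition weighted_hypergraph :: "('v::finite) set set \<Rightarrow> ('v set \<Rightarrow> real) \<Rightarrow> bool" where
  "weighted_hypergraph E w \<longleftrightarrow>
     2 \<le> CARD('v) \<and> (\<forall>e\<in>E. 2 \<le> card e) \<and> (\<forall>e\<in>E. 0 < w e)"

definition connected_hypergraph :: "('v::finite) set set \<Rightarrow> bool" where
  "connected_hypergraph E \<longleftrightarrow> (\<forall>u v. (u, v) \<in> {(x, y). \<exists>e\<in>E. x \<in> e \<and> y \<in> e}\<^sup>*)"

definition node_degree :: "('v::finite) set set \<Rightarrow> 'v \<Rightarrow> nat" where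
  "node_degree E v = card {e \<in> E. v \<in> e}"

definition incidences :: "('v::finite) set set \<Rightarrow> ('v set \<times> 'v) set" where
  "incidences E = {(e, v). e \<in> E \<and> v \<in> e}"

text \<open>
  The incidence set depends on the hypergraph, so it cannot be an index type.  Matrices
  indexed by it are extended by zero to the index type \<open>'v set \<times> 'v\<close>: every row and
  column outside \<open>incidences E\<close> vanishes.  Products, transposes and Frobenius inner
  products of such matrices are those of the unextended ones.
\<close>

definition diag :: "('i::finite \<Rightarrow> real) \<Rightarrow> real^'i^'i" where
  "diag c = (\<chi> i j. if i = j then c i else 0)"

definition diff_op :: "('v::finite) set set \<Rightarrow> real^'v \<Rightarrow> real^('v set \<times> 'v)" where
  "diff_op E f = (\<chi> i. case i of (e, v) \<Rightarrow>
     if (e, v) \<in> incidences E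
     then f $ v / sqrt (real (node_degree E v))
        - (1 / real (card e)) * (\<Sum>u\<in>e. f $ u / sqrt (real (node_degree E u)))
     else 0)"

definition sqrt_weights ::
  "('v::finite) set set \<Rightarrow> ('v set \<Rightarrow> real) \<Rightarrow> real^('v set \<times> 'v)^('v set \<times> 'v)" where
  "sqrt_weights E w =
     diag (\<lambda>(e, v). if (e, v) \<in> incidences E then sqrt (w e) else 0)"

definition grad_matrix ::
  "('v::finite) set set \<Rightarrow> ('v set \<Rightarrow> real) \<Rightarrow> real^'v^('v set \<times> 'v)" where
  "grad_matrix E w = sqrt_weights E w ** matrix (diff_op E)"

definition locally_lipschitz :: "('a::metric_space \<Rightarrow> 'b::metric_space) \<Rightarrow> bool" where
  "locally_lipschitz f \<longleftrightarrow> (\<forall>x. \<exists>u>0. \<exists>C. lipschitz_on C (cball x u) f)"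

definition leaky_relu :: "real \<Rightarrow> real \<Rightarrow> real" where
  "leaky_relu \<alpha> x = (if 0 \<le> x then x else \<alpha> * x)"

text \<open>
  A unit is a pair of a weight vector and a bias, a layer is a list of units.  The
  parameters of a multilayer perceptron are its first layer, which reads the input vector,
  and the list of the subsequent layers, which read the activated outputs of the previous
  layer.  Well-formedness says that the widths match and that the output is one real number.
\<close>

type_synonym 'k mlp_params = "((real^'k) \<times> real) list \<times> (real list \<times> real) list list"

definition dense :: "(real list \<times> real) list \<Rightarrow> real list \<Rightarrow> real list" where
  "dense L y = map (\<lambda>(c, b). (\<Sum>i<length y. c ! i * y ! i) + b) L"

definition mlp :: "(real \<Rightarrow> real) \<Rightarrow> ('k::finite) mlp_params \<Rightarrow> real^'k \<Rightarrow> real" where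
  "mlp \<rho> \<theta> x =
     hd (foldl (\<lambda>y L. dense L (map \<rho> y)) (map (\<lambda>(c, b). c \<bullet> x + b) (fst \<theta>)) (snd \<theta>))"

fun wf_layers :: "nat \<Rightarrow> (real list \<times> real) list list \<Rightarrow> bool" where
  "wf_layers m [] \<longleftrightarrow> m = 1"
| "wf_layers m (L # Ls) \<longleftrightarrow> L \<noteq> [] \<and> (\<forall>(c, b)\<in>set L. length c = m) \<and> wf_layers (length L) Ls"

definition wf_mlp :: "('k::finite) mlp_params \<Rightarrow> bool" where
  "wf_mlp \<theta> \<longleftrightarrow> fst \<theta> \<noteq> [] \<and> wf_layers (length (fst \<theta>)) (snd \<theta>)"

definition vconcat :: "real^'d \<Rightarrow> real^'d \<Rightarrow> real^('d + 'd::finite)" where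
  "vconcat x y = (\<chi> k. case k of Inl j \<Rightarrow> x $ j | Inr j \<Rightarrow> y $ j)"

text \<open>
  An aggregator takes the multiset of the representations of a set of nodes, which builds
  in permutation invariance.
\<close>

definition agg_rep ::
  "((real^'d) multiset \<Rightarrow> real^'d) \<Rightarrow> real^'d^'v \<Rightarrow> ('v::finite) set \<Rightarrow> real^'d" where
  "agg_rep Agg X e = Agg (image_mset (\<lambda>u. X $ u) (mset_set e))"

definition score ::
  "((real^'d) multiset \<Rightarrow> real^'d) \<Rightarrow> real \<Rightarrow> (real \<Rightarrow> real) \<Rightarrow> ('d + 'd::finite) mlp_params \<Rightarrow>
   real^'d^'v \<Rightarrow> ('v::finite) set \<Rightarrow> 'v \<Rightarrow> real" where
  "score Agg \<alpha> \<rho> \<theta> X e v = leaky_relu \<alpha> (mlp \<rho> \<theta> (vconcat (X $ v) (agg_rep Agg X e)))"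

definition modulation ::
  "('v::finite) set set \<Rightarrow> real \<Rightarrow> ('v set \<Rightarrow> 'v \<Rightarrow> real) \<Rightarrow> 'v set \<Rightarrow> 'v \<Rightarrow> real" where
  "modulation E \<epsilon> r e v =
     (1 - \<epsilon>) * (exp (r e v) / (\<Sum>e'\<in>{e' \<in> E. v \<in> e'}. exp (r e' v)))
     + \<epsilon> / real (node_degree E v)"

definition modulation_matrix ::
  "('v::finite) set set \<Rightarrow> real \<Rightarrow> ((real^'d) multiset \<Rightarrow> real^'d) \<Rightarrow> real \<Rightarrow>
   (real \<Rightarrow> real) \<Rightarrow> ('d + 'd::finite) mlp_params \<Rightarrow> real^'d^'v \<Rightarrow>
   real^('v set \<times> 'v)^('v set \<times> 'v)" where
  "modulation_matrix E \<epsilon> Agg \<alpha> \<rho> \<theta> X =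
     diag (\<lambda>(e, v). if (e, v) \<in> incidences E
                    then modulation E \<epsilon> (score Agg \<alpha> \<rho> \<theta> X) e v else 0)"

definition null_mode :: "('v::finite) set set \<Rightarrow> real^'v" where
  "null_mode E = diag (\<lambda>v. sqrt (real (node_degree E v))) *v 1"

definition null_space :: "('v::finite) set set \<Rightarrow> (real^'d^'v) set" where
  "null_space E = range (\<lambda>c :: real^'d^1. columnvector (null_mode E) ** c)"

definition orth_proj :: "('a::euclidean_space) set \<Rightarrow> 'a \<Rightarrow> 'a" where
  "orth_proj W x = (THE y. y \<in> W \<and> x - y \<in> W\<^sup>\<bottom>)"

definition Q_proj :: "('v::finite) set set \<Rightarrow> real^'d^'v \<Rightarrow> real^'d^'v" where
  "Q_proj E X = X - orth_proj (null_space E) X"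

definition softplus :: "real \<Rightarrow> real" where
  "softplus \<eta> = ln (1 + exp \<eta>)"

definition rayleigh ::
  "('v::finite) set set \<Rightarrow> ('v set \<Rightarrow> real) \<Rightarrow>
   (real^'d^'v \<Rightarrow> real^('v set \<times> 'v)^('v set \<times> 'v)) \<Rightarrow> real^'d^'v \<Rightarrow> real" where
  "rayleigh E w A X =
     (let Z = Q_proj E X; G = grad_matrix E w in
      if Z = 0 then 0 else ((G ** Z) \<bullet> (A X ** (G ** Z))) / (norm Z)\<^sup>2)"

definition reaction ::
  "('v::finite) set set \<Rightarrow> ('v set \<Rightarrow> real) \<Rightarrow>
   (real^'d^'v \<Rightarrow> real^('v set \<times> 'v)^('v set \<times> 'v)) \<Rightarrow> real \<Rightarrow> real^'d^'v \<Rightarrow> real^'d^'v" where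
  "reaction E w A \<eta> X =
     (rayleigh E w A X + tanh (softplus \<eta> - (norm (Q_proj E X))\<^sup>2)) *\<^sub>R Q_proj E X"

definition hnrd_field ::
  "('v::finite) set set \<Rightarrow> ('v set \<Rightarrow> real) \<Rightarrow>
   (real^'d^'v \<Rightarrow> real^('v set \<times> 'v)^('v set \<times> 'v)) \<Rightarrow> real \<Rightarrow> real^'d^'v \<Rightarrow> real^'d^'v" where
  "hnrd_field E w A \<eta> X =
     - (transpose (grad_matrix E w) ** A X ** grad_matrix E w ** X) + reaction E w A \<eta> X"

text \<open>
  Times are nonnegative; values of a semiflow at negative times are irrelevant.  The derivative
  at time 0 is one-sided, and continuity of the derivative is stated for \<open>f \<circ> x\<close>, which it equals.
\<close>

definition global_C1_solution ::
  "('a::real_normed_vector \<Rightarrow> 'a) \<Rightarrow> 'a \<Rightarrow> (real \<Rightarrow> 'a) \<Rightarrow> bool" where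
  "global_C1_solution f x0 x \<longleftrightarrow>
     x 0 = x0 \<and>
     (\<forall>t\<ge>0. (x has_vector_derivative f (x t)) (at t within {0..})) \<and>
     continuous_on {0..} (\<lambda>t. f (x t))"

definition continuous_semiflow :: "(real \<Rightarrow> 'a::real_normed_vector \<Rightarrow> 'a) \<Rightarrow> bool" where
  "continuous_semiflow S \<longleftrightarrow>
     (\<forall>x. S 0 x = x) \<and>
     (\<forall>s\<ge>0. \<forall>t\<ge>0. \<forall>x. S (s + t) x = S s (S t x)) \<and>
     continuous_on ({0..} \<times> UNIV) (\<lambda>(t, x). S t x)"

definition generates_semiflow ::
  "('a::real_normed_vector \<Rightarrow> 'a) \<Rightarrow> (real \<Rightarrow> 'a \<Rightarrow> 'a) \<Rightarrow> bool" where
  "generates_semiflow f S \<longleftrightarrow>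
     continuous_semiflow S \<and>
     (\<forall>x0. global_C1_solution f x0 (\<lambda>t. S t x0) \<and>
           (\<forall>x. global_C1_solution f x0 x \<longrightarrow> (\<forall>t\<ge>0. x t = S t x0)))"

definition energy ::
  "('v::finite) set set \<Rightarrow> real^'v^'v \<Rightarrow> real^'d^'v \<Rightarrow> real" where
  "energy E L X = (1 / 2) * (Q_proj E X \<bullet> (L ** Q_proj E X))"

text \<open>
  \<open>LEAST\<close> and \<open>GREATEST\<close> denote an attained minimum and maximum and are unspecified if
  there is none, unlike \<open>Inf\<close> and \<open>Sup\<close>.
\<close>

definition rayleigh_min :: "real^'v^'v \<Rightarrow> (real^'d^'v::finite) set \<Rightarrow> real" where
  "rayleigh_min L W = (LEAST r. \<exists>Z\<in>W. norm Z = 1 \<and> r = Z \<bullet> (L ** Z))"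

definition rayleigh_max :: "real^'v^'v \<Rightarrow> (real^'d^'v::finite) set \<Rightarrow> real" where
  "rayleigh_max L W = (GREATEST r. \<exists>Z\<in>W. norm Z = 1 \<and> r = Z \<bullet> (L ** Z))"

end

theory Submission
  imports Defs
begin

text \<open>
  Since \<open>G\<close> annihilates \<open>\<phi>\<close>, the Rayleigh quotient in the reaction term cancels the diffusion
  exactly when the equation is paired with \<open>Q X\<close>.  Hence \<open>y = \<parallel>Q X\<parallel>\<^sup>2\<close> satisfies the autonomous
  scalar equation \<open>y' = 2 y tanh (\<tau> - y)\<close>, whatever the modulation is.  Along it \<open>\<bar>y - \<tau>\<bar>\<close> is
  nonincreasing, and \<open>y - \<tau> ln y\<close>, which is bounded below, has derivative
  \<open>-2 (\<tau> - y) tanh (\<tau> - y)\<close>, so \<open>y\<close> cannot stay away from \<open>\<tau>\<close> and therefore tends to \<open>\<tau>\<close>.  The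
  energy lies between \<open>\<lambda>\<^sub>2 y / 2\<close> and \<open>\<lambda>\<^sub>m\<^sub>a\<^sub>x y / 2\<close>.
\<close>

section \<open>The scalar equation \<open>y' = 2 y tanh (\<tau> - y)\<close>\<close>

lemma abs_mult_tanh_abs: "\<bar>x\<bar> * tanh \<bar>x\<bar> = x * tanh (x::real)"
  by (cases "0 \<le> x") simp_all

lemma mult_tanh_nonneg: "0 \<le> x * tanh (x::real)"
  by (subst abs_mult_tanh_abs[symmetric]) simp

lemma tanh_ode_tendsto:
  fixes y :: "real \<Rightarrow> real"
  assumes cont: "continuous_on {0..} y"
    and deriv: "\<And>t. 0 < t \<Longrightarrow> (y has_real_derivative 2 * y t * tanh (\<tau> - y t)) (at t)"
    and nonneg: "\<And>t. 0 \<le> t \<Longrightarrow> 0 \<le> y t"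
    and "0 < y 0" and "0 < \<tau>"
  shows "(y \<longlongrightarrow> \<tau>) at_top"
proof -
  have contI: "continuous_on {s..t} y" if "0 \<le> s" for s t
    using cont by (rule continuous_on_subset) (use that in auto)
  have pos: "0 < y t" if t: "0 \<le> t" for t
  proof -
    \<comment> \<open>Since \<open>tanh > -1\<close> and \<open>y \<ge> 0\<close>, the equation
      gives \<open>y' \<ge> -2 y\<close>. With the integrating factor \<open>exp (2 t)\<close> this
      becomes monotonicity, so \<open>y\<close> cannot reach zero in finite time.\<close>
    have "exp (2 * 0) * y 0 \<le> exp (2 * t) * y t"
    proof (rule DERIV_nonneg_imp_increasing_open[OF t])
      fix x assume x: "0 < x" "x < t"
      have "0 \<le> exp (2 * x) * (2 * y x * (1 + tanh (\<tau> - y x)))"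
        using nonneg[of x] x tanh_real_gt_neg1[of "\<tau> - y x"] by simp
      moreover have "((\<lambda>t. exp (2 * t) * y t) has_real_derivative
          exp (2 * x) * (2 * y x * (1 + tanh (\<tau> - y x)))) (at x)"
        by (rule derivative_eq_intros deriv x refl | simp add: algebra_simps)+
      ultimately show "\<exists>d. ((\<lambda>t. exp (2 * t) * y t) has_real_derivative d) (at x) \<and> 0 \<le> d"
        by blast
    qed (intro continuous_intros contI order_refl)
    then have "0 < exp (2 * t) * y t" using \<open>0 < y 0\<close> by simp
    then show ?thesis by (simp add: zero_less_mult_iff)
  qed
  have dist_mono: "\<bar>y t - \<tau>\<bar> \<le> \<bar>y s - \<tau>\<bar>" if st: "0 \<le> s" "s \<le> t" for s t
  proof -
    \<comment> \<open>The square replaces the absolute value to be differentiable where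
      \<open>y\<close> meets \<tau>. Its derivative is nonpositive because
      \<open>x tanh x \<ge> 0\<close>.\<close>
    have "(y t - \<tau>)\<^sup>2 \<le> (y s - \<tau>)\<^sup>2"
    proof (rule DERIV_nonpos_imp_decreasing_open[OF st(2)])
      fix x assume x: "s < x" "x < t"
      have "0 \<le> 4 * (y x * ((\<tau> - y x) * tanh (\<tau> - y x)))"
        using nonneg[of x] x st mult_tanh_nonneg[of "\<tau> - y x"] by simp
      moreover have "((\<lambda>t. (y t - \<tau>)\<^sup>2) has_real_derivative
          - (4 * (y x * ((\<tau> - y x) * tanh (\<tau> - y x))))) (at x)"
        by (rule derivative_eq_intros deriv refl | use x st in \<open>simp add: algebra_simps\<close>)+
      ultimately show "\<exists>d. ((\<lambda>t. (y t - \<tau>)\<^sup>2) has_real_derivative d) (at x) \<and> d \<le> 0"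
        by (metis neg_le_0_iff_le)
    qed (intro continuous_intros contI st)
    then show ?thesis by (simp add: abs_le_square_iff)
  qed
  have enter: "\<exists>t\<ge>0. \<bar>y t - \<tau>\<bar> < a" if a: "0 < a" for a
  proof (rule ccontr)
    assume "\<not> ?thesis"
    then have far: "a \<le> \<bar>\<tau> - y t\<bar>" if "0 \<le> t" for t
      using that by (metis abs_minus_commute not_less)
    \<comment> \<open>As long as \<open>y\<close> stays at distance at least \<open>a\<close> from
      \<tau>, \<open>c\<close> bounds the dissipation from below: \<open>x tanh x\<close> is even
      and grows with \<open>\<bar>x\<bar>\<close>.\<close>
    define c where "c = 2 * (a * tanh a)"
    have c: "0 < c" using a by (simp add: c_def)
    have rate: "c \<le> 2 * ((\<tau> - y t) * tanh (\<tau> - y t))" if "0 \<le> t" for t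
    proof -
      have "a * tanh a \<le> \<bar>\<tau> - y t\<bar> * tanh \<bar>\<tau> - y t\<bar>"
        using far[OF that] a
        by (intro mult_mono) (simp_all add: tanh_real_le_iff del: tanh_real_abs)
      also have "\<dots> = (\<tau> - y t) * tanh (\<tau> - y t)"
        by (rule abs_mult_tanh_abs)
      finally show ?thesis by (simp add: c_def)
    qed
    \<comment> \<open>The derivative \<open>1 - \<tau> / y\<close> of \<open>y - \<tau> ln y\<close>
      cancels the factor \<open>y\<close> of the equation, so the decay rate is at least
      \<open>c\<close> even where \<open>y\<close> is small. Adding \<open>c t\<close> compensates
      exactly this rate.\<close>
    have bound: "y t - \<tau> * ln (y t) + c * t \<le> y 0 - \<tau> * ln (y 0) + c * 0" if t: "0 \<le> t" for t
    proof (rule DERIV_nonpos_imp_decreasing_open[OF t])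
      fix x assume x: "0 < x" "x < t"
      have "((\<lambda>t. y t - \<tau> * ln (y t) + c * t) has_real_derivative
          - (2 * ((\<tau> - y x) * tanh (\<tau> - y x))) + c) (at x)"
        by (rule derivative_eq_intros deriv refl
            | use x pos[of x] in \<open>simp add: field_simps\<close>)+
      then show "\<exists>d. ((\<lambda>t. y t - \<tau> * ln (y t) + c * t) has_real_derivative d) (at x) \<and> d \<le> 0"
        using rate[of x] x by (intro exI conjI) auto
    qed (intro continuous_intros contI order_refl ballI pos less_imp_neq[symmetric]; auto intro: pos)
    \<comment> \<open>The function \<open>y - \<tau> ln y\<close> is smallest at
      \<open>y = \<tau>\<close>; this is \<open>ln x \<le> x - 1\<close> at
      \<open>x = y / \<tau>\<close>.\<close>
    have gibbs: "\<tau> - \<tau> * ln \<tau> \<le> y t - \<tau> * ln (y t)" if "0 \<le> t" for t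
    proof -
      have "ln (y t / \<tau>) \<le> y t / \<tau> - 1"
        using pos[OF that] \<open>0 < \<tau>\<close> by (intro ln_le_minus_one) simp
      then have "\<tau> * ln (y t / \<tau>) \<le> y t - \<tau>"
        using \<open>0 < \<tau>\<close> by (simp add: field_simps)
      then show ?thesis
        using pos[OF that] \<open>0 < \<tau>\<close> by (simp add: ln_div algebra_simps)
    qed
    \<comment> \<open>By time \<open>T\<close> the guaranteed decrease \<open>c T\<close> exceeds by
      one the gap between the initial value and the minimum, which is absurd.\<close>
    define T where "T = (\<bar>y 0 - \<tau> * ln (y 0) - (\<tau> - \<tau> * ln \<tau>)\<bar> + 1) / c"
    have "0 \<le> T" using c by (simp add: T_def)
    moreover have "c * T = \<bar>y 0 - \<tau> * ln (y 0) - (\<tau> - \<tau> * ln \<tau>)\<bar> + 1"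
      using c by (simp add: T_def)
    ultimately show False using bound[of T] gibbs[of T] by linarith
  qed
  show ?thesis
  \<comment> \<open>Once \<open>y\<close> has come within \<open>a\<close> of \<tau>, the monotone
    distance keeps it there.\<close>
  proof (rule tendstoI)
    fix a :: real assume "0 < a"
    then obtain s where s: "0 \<le> s" "\<bar>y s - \<tau>\<bar> < a" using enter by blast
    show "\<forall>\<^sub>F t in at_top. dist (y t) \<tau> < a"
      using eventually_ge_at_top[of s]
      by eventually_elim (use dist_mono[OF s(1)] s(2) in \<open>force simp: dist_real_def\<close>)
  qed
qed

section \<open>Frobenius products and matrix action, column by column\<close>

lemma inner_columns:
  fixes X Y :: "real^'d^'n"
  shows "X \<bullet> Y = (\<Sum>j\<in>UNIV. column j X \<bullet> column j Y)"
  unfolding inner_vec_def column_def by (simp add: sum.swap[of _ "UNIV :: 'd set"])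

lemma column_matrix_mult: "column j (A ** B) = A *v column j B"
  by (simp add: column_def matrix_matrix_mult_def matrix_vector_mult_def vec_eq_iff)

lemma inner_matrix_mult_transpose:
  fixes M :: "real^'n^'m" and X :: "real^'d^'n"
  shows "X \<bullet> (transpose M ** Y) = (M ** X) \<bullet> Y"
  unfolding inner_columns column_matrix_mult
  by (metis dot_lmul_matrix inner_commute transpose_matrix_vector)

lemma linear_matrix_mult: "linear (\<lambda>B :: real^'d^'n. (A :: real^'n^'m) ** B)"
proof (rule linearI)
  show "A ** (c *\<^sub>R B) = c *\<^sub>R (A ** B)" for c and B :: "real^'d^'n"
    by (simp add: vec_eq_iff matrix_matrix_mult_def sum_distrib_left mult.left_commute)
qed (simp add: matrix_add_ldistrib)

section \<open>Orthogonal projection and \<open>Q_proj\<close>\<close>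

lemma orth_proj_eqI:
  assumes W: "subspace W" and "y \<in> W" "x - y \<in> W\<^sup>\<bottom>"
  shows "orth_proj W x = y"
  unfolding orth_proj_def
proof (rule the_equality)
  fix z assume z: "z \<in> W \<and> x - z \<in> W\<^sup>\<bottom>"
  then have "z - y \<in> W" using assms by (simp add: subspace_diff)
  \<comment> \<open>The difference of the two residuals is again \<open>z - y\<close>, so this
    vector lies in \<open>W\<close> and in its orthogonal complement.\<close>
  moreover have "(x - y) - (x - z) \<in> W\<^sup>\<bottom>"
    using subspace_diff[OF subspace_orthogonal_comp] assms z by blast
  ultimately have "z - y \<in> W \<inter> W\<^sup>\<bottom>" by simp
  then show "z = y" using orthogonal_Int_0[OF W] by simp
qed (use assms in simp)

lemma orth_proj_decomp:
  assumes W: "subspace W"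
  shows "orth_proj W x \<in> W" "x - orth_proj W x \<in> W\<^sup>\<bottom>"
proof -
  have "x \<in> W + W\<^sup>\<bottom>" using subspace_sum_orthogonal_comp[OF W] by simp
  then obtain y z where "x = y + z" "y \<in> W" "z \<in> W\<^sup>\<bottom>" by (rule set_plus_elim)
  then have y: "y \<in> W" "x - y \<in> W\<^sup>\<bottom>" by simp_all
  with orth_proj_eqI[OF W y] show "orth_proj W x \<in> W" "x - orth_proj W x \<in> W\<^sup>\<bottom>" by simp_all
qed

text \<open>Sums and multiples of projections again split off a residual orthogonal to
  \<open>W\<close>, so uniqueness of the splitting identifies them as projections.\<close>

lemma linear_orth_proj:
  assumes W: "subspace W"
  shows "linear (orth_proj W)"
proof (rule linearI)
  note d = orth_proj_decomp[OF W]
  fix x y c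
  have "(x - orth_proj W x) + (y - orth_proj W y) \<in> W\<^sup>\<bottom>"
    by (intro subspace_add subspace_orthogonal_comp d)
  then show "orth_proj W (x + y) = orth_proj W x + orth_proj W y"
    by (intro orth_proj_eqI W subspace_add d) (simp add: algebra_simps)
  have "c *\<^sub>R (x - orth_proj W x) \<in> W\<^sup>\<bottom>"
    by (intro subspace_scale subspace_orthogonal_comp d)
  then show "orth_proj W (c *\<^sub>R x) = c *\<^sub>R orth_proj W x"
    by (intro orth_proj_eqI W subspace_scale d) (simp add: algebra_simps)
qed

lemma subspace_null_space: "subspace (null_space E :: (real^'d^'v::finite) set)"
  unfolding null_space_def by (rule linear_subspace_image[OF linear_matrix_mult subspace_UNIV])

lemma linear_Q_proj: "linear (Q_proj E :: real^'d^'v::finite \<Rightarrow> _)"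
  unfolding Q_proj_def
  by (intro linear_compose_sub linear_orth_proj subspace_null_space) (simp add: linear_ident)

lemma Q_proj_mem: "Q_proj E X \<in> (null_space E)\<^sup>\<bottom>"
  unfolding Q_proj_def by (rule orth_proj_decomp(2)[OF subspace_null_space])

lemma diff_Q_proj_mem: "X - Q_proj E X \<in> null_space E"
  unfolding Q_proj_def using orth_proj_decomp(1)[OF subspace_null_space] by simp

text \<open>The part of \<open>Y\<close> that \<open>Q_proj\<close> removes lies in the null space,
  orthogonal to \<open>Q_proj E X\<close>. This later strips the projection from the vector field
  when the squared norm is differentiated.\<close>

lemma inner_Q_proj: "Q_proj E X \<bullet> Q_proj E Y = Q_proj E X \<bullet> Y"
proof -
  have "Q_proj E X \<bullet> (Y - Q_proj E Y) = 0"
    using Q_proj_mem[of E X] diff_Q_proj_mem[of Y E]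
    unfolding orthogonal_comp_def orthogonal_def mem_Collect_eq by (metis inner_commute)
  then show ?thesis by (simp add: inner_diff_right)
qed

section \<open>The gradient on the null mode, and cancellation of diffusion against reaction\<close>

lemma linear_diff_op: "linear (diff_op E)"
  by (rule linearI)
    (auto simp: diff_op_def vec_eq_iff add_divide_distrib sum.distrib sum_distrib_left
      algebra_simps split: prod.split)

lemma null_mode_nth: "null_mode E $ v = sqrt (real (node_degree E v))"
  by (simp add: null_mode_def diag_def matrix_vector_mult_def)

lemma node_degree_pos: "e \<in> E \<Longrightarrow> v \<in> e \<Longrightarrow> 0 < node_degree E v"
  unfolding node_degree_def by (subst card_gt_0_iff) auto

text \<open>Normalising \<phi> by the square roots of the degrees gives the constant one, which
  agrees with its mean over every hyperedge.\<close>

lemma diff_op_null_mode: "diff_op E (null_mode E) = 0"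
proof -
  \<comment> \<open>A node of a hyperedge has positive degree, so the quotient is not a division by
    zero.\<close>
  have one: "null_mode E $ u / sqrt (real (node_degree E u)) = 1" if "e \<in> E" "u \<in> e" for e u
    using node_degree_pos[OF that] by (simp add: null_mode_nth)
  have "(\<Sum>u\<in>e. null_mode E $ u / sqrt (real (node_degree E u))) = real (card e)"
    if "e \<in> E" for e
    using sum.cong[OF refl one[OF that], of e] by simp
  then have "diff_op E (null_mode E) $ (e, v) = 0" for e v
    using one[of e v] by (cases "e \<in> E \<and> v \<in> e")
      (auto simp: diff_op_def incidences_def card_eq_0_iff simp del: divide_eq_1_iff)
  then show ?thesis by (simp add: vec_eq_iff)
qed

lemma grad_matrix_null_mode: "grad_matrix E w *v null_mode E = 0"
  unfolding grad_matrix_def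
  by (simp add: matrix_works[OF linear_matrix_vector_mul_eq[THEN iffD2, OF linear_diff_op]] diff_op_null_mode
      flip: matrix_vector_mul_assoc)

text \<open>Elements of the null space are products of the column \<phi> with a row, and
  associativity lets the gradient act on \<phi> first.\<close>

lemma grad_matrix_null_space:
  assumes "Y \<in> null_space E"
  shows "grad_matrix E w ** Y = 0"
proof -
  obtain c :: "real^'a^1" where "Y = columnvector (null_mode E) ** c"
    using assms by (auto simp: null_space_def)
  then have "grad_matrix E w ** Y = columnvector (grad_matrix E w *v null_mode E) ** c"
    by (simp add: matrix_mul_assoc dot_rowvector_columnvector)
  then show ?thesis
    by (simp add: grad_matrix_null_mode columnvector_def matrix_matrix_mult_def vec_eq_iff)
qed

lemma grad_matrix_Q_proj: "grad_matrix E w ** X = grad_matrix E w ** Q_proj E X"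
  using grad_matrix_null_space[OF diff_Q_proj_mem, of E w X]
  by (simp add: linear_diff[OF linear_matrix_mult])

text \<open>Moving \<open>transpose G\<close> across the product and replacing \<open>G X\<close> by
  \<open>G Z\<close> turns the diffusion into the quadratic form in the numerator of the Rayleigh
  quotient. The two cancel and only the \<open>tanh\<close> term survives.\<close>

lemma inner_Q_proj_hnrd_field:
  "Q_proj E X \<bullet> hnrd_field E w A \<eta> X
    = (norm (Q_proj E X))\<^sup>2 * tanh (softplus \<eta> - (norm (Q_proj E X))\<^sup>2)"
proof -
  define Z where "Z = Q_proj E X"
  define G where "G = grad_matrix E w"
  have "Z \<bullet> (transpose G ** A X ** G ** X) = (G ** Z) \<bullet> (A X ** (G ** Z))"
    by (simp add: G_def Z_def inner_matrix_mult_transpose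
        flip: matrix_mul_assoc grad_matrix_Q_proj)
  \<comment> \<open>In product form the identity also covers \<open>Z = 0\<close>, where the
    quotient has the default value 0 and the right side vanishes.\<close>
  moreover have "rayleigh E w A X * (Z \<bullet> Z) = (G ** Z) \<bullet> (A X ** (G ** Z))"
    by (simp add: rayleigh_def Let_def power2_norm_eq_inner linear_0[OF linear_matrix_mult]
        flip: Z_def G_def)
  ultimately show ?thesis
    by (simp add: hnrd_field_def reaction_def inner_add_right inner_diff_right
        power2_norm_eq_inner algebra_simps flip: Z_def G_def)
qed

section \<open>Positive semidefinite forms and their kernel\<close>

lemma psd_inner_zero_imp:
  fixes L :: "real^'n^'n"
  assumes sym: "transpose L = L" and psd: "\<And>x. 0 \<le> x \<bullet> (L *v x)" and "x \<bullet> (L *v x) = 0"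
  shows "L *v x = 0"
proof -
  define y where "y = L *v x"
  define c where "c = y \<bullet> (L *v y)"
  \<comment> \<open>The form at \<open>x - s y\<close> is
    \<open>s\<^sup>2 c - 2 s (y \<bullet> y)\<close>, negative for small positive \<open>s\<close>
    unless \<open>y = 0\<close>. This step length makes it \<open>- s\<^sup>2 (c + 2)\<close>, and
    the added one allows \<open>c = 0\<close>.\<close>
  define s where "s = (y \<bullet> y) / (c + 1)"
  have c: "0 \<le> c" using psd by (simp add: c_def)
  have y: "y \<bullet> y = s * (c + 1)" using c by (simp add: s_def)
  have "x \<bullet> (L *v y) = y \<bullet> y"
    by (metis sym dot_lmul_matrix transpose_matrix_vector y_def)
  then have "0 \<le> s\<^sup>2 * c - 2 * s * (y \<bullet> y)"
    using psd[of "x - s *\<^sub>R y"] assms(3)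
    by (simp add: matrix_vector_mult_diff_distrib matrix_vector_mult_scaleR inner_diff_left
        inner_diff_right c_def power2_eq_square algebra_simps inner_commute flip: y_def)
  also have "\<dots> = - (s\<^sup>2 * (c + 2))"
    unfolding y by (simp add: algebra_simps power2_eq_square)
  finally have "s\<^sup>2 * (c + 2) \<le> 0" by simp
  then have "s = 0"
    using c by (simp add: mult_le_0_iff)
  then show ?thesis using y by (simp add: y_def)
qed

lemma null_spaceI:
  assumes "\<And>j. column j Z \<in> span {null_mode E}"
  shows "Z \<in> null_space E"
proof -
  have "\<forall>j. \<exists>k. column j Z = k *\<^sub>R null_mode E"
    using assms by (auto simp: span_singleton)
  then obtain k where "\<And>j. column j Z = k j *\<^sub>R null_mode E" by metis
  \<comment> \<open>The multipliers of the columns, collected in a single row, are the factor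
    \<open>c\<close> in the definition of the null space.\<close>
  then have "Z = columnvector (null_mode E) ** ((\<chi> i j. k j) :: real^_^1)"
    by (simp add: vec_eq_iff column_def columnvector_def matrix_matrix_mult_def mult.commute)
  then show ?thesis by (auto simp: null_space_def)
qed

text \<open>The form is a sum of nonnegative column terms. If it vanishes, every term does, which
  puts every column into the kernel of \<open>L\<close>, the span of \<phi>.\<close>

lemma psd_null_space:
  fixes Z :: "real^'d^'v::finite"
  assumes sym: "transpose L = L" and psd: "\<And>x. 0 \<le> x \<bullet> (L *v x)"
    and ker: "{x. L *v x = 0} = span {null_mode E}"
  shows "0 \<le> Z \<bullet> (L ** Z)" and "Z \<bullet> (L ** Z) = 0 \<Longrightarrow> Z \<in> null_space E"
proof -
  have eq: "Z \<bullet> (L ** Z) = (\<Sum>j\<in>UNIV. column j Z \<bullet> (L *v column j Z))"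
    by (simp add: inner_columns column_matrix_mult)
  show "0 \<le> Z \<bullet> (L ** Z)" unfolding eq by (intro sum_nonneg psd)
  assume "Z \<bullet> (L ** Z) = 0"
  then have "column j Z \<bullet> (L *v column j Z) = 0" for j
    unfolding eq by (simp add: sum_nonneg_eq_0_iff psd)
  then have "column j Z \<in> span {null_mode E}" for j
    using psd_inner_zero_imp[OF sym psd] ker by blast
  then show "Z \<in> null_space E" by (rule null_spaceI)
qed

section \<open>Extremal values on the unit sphere of a subspace\<close>

lemma continuous_on_quadratic_form:
  fixes L :: "real^'n^'n"
  shows "continuous_on K (\<lambda>Z :: real^'d^'n. Z \<bullet> (L ** Z))"
  by (intro continuous_on_inner continuous_on_id linear_continuous_on
      linear_conv_bounded_linear[THEN iffD1] linear_matrix_mult)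

lemma compact_subspace_sphere:
  fixes W :: "'a::euclidean_space set"
  assumes "subspace W"
  shows "compact {Z \<in> W. norm Z = 1}"
proof -
  have "{Z \<in> W. norm Z = 1} = sphere 0 1 \<inter> W" by auto
  then show ?thesis
    using closed_subspace[OF assms] by (simp add: compact_Int_closed)
qed

lemma subspace_sphere_nonempty:
  assumes "subspace W" "z \<in> W" "z \<noteq> 0"
  shows "{Z \<in> W. norm Z = 1} \<noteq> {}"
proof -
  have "(1 / norm z) *\<^sub>R z \<in> {Z \<in> W. norm Z = 1}"
    using assms by (simp add: subspace_scale)
  then show ?thesis by blast
qed

lemma quadratic_form_scaleR:
  fixes L :: "real^'n^'n" and Z :: "real^'d^'n"
  shows "(c *\<^sub>R Z) \<bullet> (L ** (c *\<^sub>R Z)) = c\<^sup>2 * (Z \<bullet> (L ** Z))"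
  by (simp add: linear_scale[OF linear_matrix_mult] power2_eq_square)

text \<open>\<open>LEAST\<close> is meaningful here because a continuous form attains its infimum on
  the compact sphere of \<open>W\<close>; the vector \<open>z\<close> makes that sphere
  nonempty.\<close>

lemma rayleigh_min_attained:
  fixes W :: "(real^'d^'v::finite) set"
  assumes "subspace W" "z \<in> W" "z \<noteq> 0"
  obtains Z where "Z \<in> W" "norm Z = 1" "rayleigh_min L W = Z \<bullet> (L ** Z)"
    "\<And>Y. Y \<in> W \<Longrightarrow> norm Y = 1 \<Longrightarrow> rayleigh_min L W \<le> Y \<bullet> (L ** Y)"
proof -
  obtain Z where Z: "Z \<in> W" "norm Z = 1"
      "\<And>Y. Y \<in> W \<Longrightarrow> norm Y = 1 \<Longrightarrow> Z \<bullet> (L ** Z) \<le> Y \<bullet> (L ** Y)"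
    using continuous_attains_inf[OF compact_subspace_sphere[OF assms(1)]
        subspace_sphere_nonempty[OF assms] continuous_on_quadratic_form[of _ L]]
    by auto
  then have "rayleigh_min L W = Z \<bullet> (L ** Z)"
    unfolding rayleigh_min_def by (intro Least_equality) auto
  with Z show thesis using that by simp
qed

lemma rayleigh_max_attained:
  fixes W :: "(real^'d^'v::finite) set"
  assumes "subspace W" "z \<in> W" "z \<noteq> 0"
  obtains Z where "Z \<in> W" "norm Z = 1" "rayleigh_max L W = Z \<bullet> (L ** Z)"
    "\<And>Y. Y \<in> W \<Longrightarrow> norm Y = 1 \<Longrightarrow> Y \<bullet> (L ** Y) \<le> rayleigh_max L W"
proof -
  obtain Z where Z: "Z \<in> W" "norm Z = 1"
      "\<And>Y. Y \<in> W \<Longrightarrow> norm Y = 1 \<Longrightarrow> Y \<bullet> (L ** Y) \<le> Z \<bullet> (L ** Z)"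
    using continuous_attains_sup[OF compact_subspace_sphere[OF assms(1)]
        subspace_sphere_nonempty[OF assms] continuous_on_quadratic_form[of _ L]]
    by auto
  then have "rayleigh_max L W = Z \<bullet> (L ** Z)"
    unfolding rayleigh_max_def by (intro Greatest_equality) auto
  with Z show thesis using that by simp
qed

lemma rayleigh_bounds:
  fixes W :: "(real^'d^'v::finite) set"
  assumes W: "subspace W" and Y: "Y \<in> W"
  shows "rayleigh_min L W * (norm Y)\<^sup>2 \<le> Y \<bullet> (L ** Y)"
    and "Y \<bullet> (L ** Y) \<le> rayleigh_max L W * (norm Y)\<^sup>2"
proof -
  have "rayleigh_min L W * (norm Y)\<^sup>2 \<le> Y \<bullet> (L ** Y)
      \<and> Y \<bullet> (L ** Y) \<le> rayleigh_max L W * (norm Y)\<^sup>2"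
  \<comment> \<open>For \<open>Y = 0\<close> the subspace may contain no unit vector, but all terms
    are zero. Otherwise normalise \<open>Y\<close> and use that the form is homogeneous of degree
    two.\<close>
  proof (cases "Y = 0")
    case False
    define U where "U = (1 / norm Y) *\<^sub>R Y"
    have U: "U \<in> W" "norm U = 1" using W Y False by (simp_all add: U_def subspace_scale)
    have "Y = norm Y *\<^sub>R U" using False by (simp add: U_def)
    then have "Y \<bullet> (L ** Y) = (norm Y)\<^sup>2 * (U \<bullet> (L ** U))"
      by (metis quadratic_form_scaleR)
    moreover have "rayleigh_min L W \<le> U \<bullet> (L ** U)"
      using rayleigh_min_attained[OF W Y False] U by metis
    moreover have "U \<bullet> (L ** U) \<le> rayleigh_max L W"
      using rayleigh_max_attained[OF W Y False] U by metis
    ultimately show ?thesis by (simp add: mult.commute[of _ "U \<bullet> _"] mult_right_mono)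
  qed simp
  then show "rayleigh_min L W * (norm Y)\<^sup>2 \<le> Y \<bullet> (L ** Y)"
    "Y \<bullet> (L ** Y) \<le> rayleigh_max L W * (norm Y)\<^sup>2" by simp_all
qed

section \<open>Convergence of the squared norm along a solution\<close>

lemma norm_Q_proj_tendsto:
  fixes x :: "real \<Rightarrow> real^'d^'v::finite"
  assumes sol: "global_C1_solution (hnrd_field E w A \<eta>) x0 x" and x0: "Q_proj E x0 \<noteq> 0"
  shows "((\<lambda>t. (norm (Q_proj E (x t)))\<^sup>2) \<longlongrightarrow> softplus \<eta>) at_top"
proof (rule tanh_ode_tendsto)
  let ?y = "\<lambda>t. (norm (Q_proj E (x t)))\<^sup>2"
  have Q: "bounded_linear (Q_proj E :: real^'d^'v \<Rightarrow> _)"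
    using linear_Q_proj by (simp add: linear_conv_bounded_linear)
  have der: "(?y has_real_derivative 2 * ?y t * tanh (softplus \<eta> - ?y t)) (at t within {0..})"
    if "0 \<le> t" for t
  proof -
    have "(x has_vector_derivative hnrd_field E w A \<eta> (x t)) (at t within {0..})"
      using sol that by (simp add: global_C1_solution_def)
    note dQ = bounded_linear.has_vector_derivative[OF Q this]
    \<comment> \<open>Both halves of the product rule agree by symmetry, and
      \<open>inner_Q_proj\<close> drops the projection of the field.\<close>
    have "Q_proj E (x t) \<bullet> Q_proj E (hnrd_field E w A \<eta> (x t))
        + Q_proj E (hnrd_field E w A \<eta> (x t)) \<bullet> Q_proj E (x t)
        = 2 * (Q_proj E (x t) \<bullet> hnrd_field E w A \<eta> (x t))"
      using inner_Q_proj[of E "x t" "hnrd_field E w A \<eta> (x t)"]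
        inner_commute[of "Q_proj E (x t)" "Q_proj E (hnrd_field E w A \<eta> (x t))"] by linarith
    then have "((\<lambda>t. Q_proj E (x t) \<bullet> Q_proj E (x t)) has_vector_derivative
        2 * (Q_proj E (x t) \<bullet> hnrd_field E w A \<eta> (x t))) (at t within {0..})"
      using bounded_bilinear.has_vector_derivative[OF bounded_bilinear_inner dQ dQ]
      by simp
    then show ?thesis
      unfolding inner_Q_proj_hnrd_field power2_norm_eq_inner[symmetric]
        has_real_derivative_iff_has_vector_derivative mult.assoc .
  qed
  show "continuous_on {0..} ?y"
    by (rule DERIV_continuous_on[OF der]) simp
  \<comment> \<open>At positive times \<open>t\<close> is interior to \<open>{0..}\<close>, so the
    one-sided derivative is a full one; at time 0 only continuity is passed on.\<close>
  show "(?y has_real_derivative 2 * ?y t * tanh (softplus \<eta> - ?y t)) (at t)" if "0 < t" for t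
    using der[of t] that at_within_interior[of t "{0..}"]
    by (simp only: interior_real_atLeast greaterThan_iff less_imp_le)
  show "0 < ?y 0" using x0 sol by (simp add: global_C1_solution_def)
  show "0 < softplus \<eta>" by (simp add: softplus_def add_pos_pos)
qed simp

theorem theorem8:
  fixes E :: "('v::finite) set set"
    and w :: "'v set \<Rightarrow> real"
    and Agg :: "(real^'d::finite) multiset \<Rightarrow> real^'d"
    and \<rho> :: "real \<Rightarrow> real"
    and \<theta> :: "('d + 'd) mlp_params"
    and \<epsilon> \<alpha> \<eta> :: real
    and S :: "real \<Rightarrow> real^'d^'v \<Rightarrow> real^'d^'v"
    and L :: "real^'v^'v"
    and X0 :: "real^'d^'v"
  assumes "weighted_hypergraph E w"
    and "connected_hypergraph E"
    and "0 < \<epsilon>" and "\<epsilon> < 1"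
    and "0 < \<alpha>" and "\<alpha> < 1"
    and "\<forall>e. e \<noteq> {} \<longrightarrow> locally_lipschitz (\<lambda>X :: real^'d^'v. agg_rep Agg X e)"
    and "wf_mlp \<theta>"
    and "locally_lipschitz (mlp \<rho> \<theta>)"
    and "generates_semiflow (hnrd_field E w (modulation_matrix E \<epsilon> Agg \<alpha> \<rho> \<theta>) \<eta>) S"
    and "transpose L = L"
    and "\<forall>x. 0 \<le> x \<bullet> (L *v x)"
    and "L *v null_mode E = 0"
    and "{x. L *v x = 0} = span {null_mode E}"
    and "Q_proj E X0 \<noteq> 0"
  shows "0 < rayleigh_min L ((null_space E :: (real^'d^'v) set)\<^sup>\<bottom>)
    \<and> ereal (rayleigh_max L ((null_space E :: (real^'d^'v) set)\<^sup>\<bottom>) / 2 * softplus \<eta>)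
        \<ge> Limsup at_top (\<lambda>t. ereal (energy E L (S t X0)))
    \<and> Limsup at_top (\<lambda>t. ereal (energy E L (S t X0)))
        \<ge> Liminf at_top (\<lambda>t. ereal (energy E L (S t X0)))
    \<and> Liminf at_top (\<lambda>t. ereal (energy E L (S t X0)))
        \<ge> ereal (rayleigh_min L ((null_space E :: (real^'d^'v) set)\<^sup>\<bottom>) / 2 * softplus \<eta>)"
proof -
  let ?W = "(null_space E :: (real^'d^'v) set)\<^sup>\<bottom>"
  let ?A = "modulation_matrix E \<epsilon> Agg \<alpha> \<rho> \<theta>"
  let ?y = "\<lambda>t. (norm (Q_proj E (S t X0)))\<^sup>2"
  have W: "subspace ?W" by (rule subspace_orthogonal_comp)
  obtain Z where Z: "Z \<in> ?W" "norm Z = 1" "rayleigh_min L ?W = Z \<bullet> (L ** Z)"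
    by (rule rayleigh_min_attained[OF W Q_proj_mem \<open>Q_proj E X0 \<noteq> 0\<close>])
  \<comment> \<open>A unit minimiser orthogonal to the null space is not in it, so by the kernel
    condition the minimum is not zero.\<close>
  have "Z \<notin> null_space E"
  proof
    assume "Z \<in> null_space E"
    with Z(1) have "Z \<in> null_space E \<inter> ?W" by (rule IntI[rotated])
    then have "Z = 0" unfolding orthogonal_Int_0[OF subspace_null_space] by (rule singletonD)
    with Z(2) show False by simp
  qed
  moreover have "0 \<le> x \<bullet> (L *v x)" for x
    using \<open>\<forall>x. 0 \<le> x \<bullet> (L *v x)\<close> by blast
  note psd = psd_null_space[OF \<open>transpose L = L\<close> this \<open>{x. L *v x = 0} = span {null_mode E}\<close>]
  ultimately have "Z \<bullet> (L ** Z) \<noteq> 0" using psd(2) by blast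
  with psd(1)[of Z] have pos: "0 < rayleigh_min L ?W" unfolding Z(3) by linarith
  have "global_C1_solution (hnrd_field E w ?A \<eta>) X0 (\<lambda>t. S t X0)"
    using \<open>generates_semiflow (hnrd_field E w ?A \<eta>) S\<close> by (simp add: generates_semiflow_def)
  then have lim: "(?y \<longlongrightarrow> softplus \<eta>) at_top"
    using \<open>Q_proj E X0 \<noteq> 0\<close> by (rule norm_Q_proj_tendsto)
  have tendsto: "((\<lambda>t. ereal (c / 2 * ?y t)) \<longlongrightarrow> ereal (c / 2 * softplus \<eta>)) at_top" for c
    by (intro tendsto_ereal tendsto_mult_left lim)
  have upper: "energy E L (S t X0) \<le> rayleigh_max L ?W / 2 * ?y t" for t
    using rayleigh_bounds(2)[OF W Q_proj_mem, where L = L] by (simp add: energy_def)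
  have lower: "rayleigh_min L ?W / 2 * ?y t \<le> energy E L (S t X0)" for t
    using rayleigh_bounds(1)[OF W Q_proj_mem, where L = L] by (simp add: energy_def)
  \<comment> \<open>The energy itself need not converge, but its two bounding multiples of
    \<open>?y\<close> do, so monotonicity of \<open>Limsup\<close> and \<open>Liminf\<close>
    transfers their limits.\<close>
  have "Limsup at_top (\<lambda>t. ereal (energy E L (S t X0)))
      \<le> Limsup at_top (\<lambda>t. ereal (rayleigh_max L ?W / 2 * ?y t))"
    by (intro Limsup_mono always_eventually allI) (simp only: ereal_less_eq upper)
  also have "\<dots> = ereal (rayleigh_max L ?W / 2 * softplus \<eta>)"
    by (intro lim_imp_Limsup tendsto) simp
  finally have "Limsup at_top (\<lambda>t. ereal (energy E L (S t X0))) \<le> \<dots>" .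
  moreover have "ereal (rayleigh_min L ?W / 2 * softplus \<eta>)
      \<le> Liminf at_top (\<lambda>t. ereal (energy E L (S t X0)))"
  proof -
    have "ereal (rayleigh_min L ?W / 2 * softplus \<eta>)
        = Liminf at_top (\<lambda>t. ereal (rayleigh_min L ?W / 2 * ?y t))"
      by (intro lim_imp_Liminf[symmetric] tendsto) simp
    also have "\<dots> \<le> Liminf at_top (\<lambda>t. ereal (energy E L (S t X0)))"
      by (intro Liminf_mono always_eventually allI) (simp only: ereal_less_eq lower)
    finally show ?thesis .
  qed
  ultimately show ?thesis
    using pos by (simp add: Liminf_le_Limsup)
qed

end
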